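(* Let $\mathcal{L}$ be a general linear system of quadrics in $\mathbb{P}^3$ (over $\mathbb{C}$) of affine dimension $4$ and of rank $5$. Then the Weddle locus $W(\mathcal{L})\subset\mathbb{P}^3$ has exactly $10$ singular points.
   Context: We work over $\mathbb{C}$. Let $n\ge 1$ and let $[x_0:\dots:x_n]$ be homogeneous coordinates on $\mathbb{P}^n$. A linear system $\mathcal{L}$ of quadrics in $\mathbb{P}^n$ is (the projectivization of) a linear subspace of the space of quadratic forms in $x_0,\dots,x_n$; its (affine) dimension $\dim\mathcal{L}$ is the dimension of this vector subspace. Suppose $\dim\mathcal{L}\le n+1$ and let $Q_0,\dots,Q_n$ be generators of $\mathcal{L}$. The Weddle matrix of $\mathcal{L}$ is the $(n+1)\times(n+1)$ matrix of linear forms $\mathbf{W}_{\mathcal{L}}=\big[\partial Q_k/\partial x_i\big]_{i,k=0,\dots,n}$ ($i$ row index, $k$ column index), and the Weddle locus of $\mathcal{L}$ is $W(\mathcal{L})=\{P\in\mathbb{P}^n : \det\mathbf{W}_{\mathcal{L}}|_P=0\}$. A singular point of $W(\mathcal{L})$ is a point of $\mathbb{P}^n$ at which all the partial derivatives of $\det\mathbf{W}_{\mathcal{L}}$ vanish. The rank of $\mathcal{L}$ is the minimal $r$ such that there are linear forms $l_1,\dots,l_r$ in $x_0,\dots,x_n$ with $\mathcal{L}\subseteq\langle l_1^2,\dots,l_r^2\rangle$ (equivalently, the partially symmetric rank of the associated tensor). "General linear system of rank $r$": consider the parameter space of pairs $((l_1,\dots,l_r),A)$, where the $l_i$ are linear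 forms in $x_0,\dots,x_n$ and $A=(A_{ik})$ is an $r\times(n+1)$ complex matrix, to which one associates the system generated by $Q_k=\sum_{i=1}^r A_{ik}l_i^2$, $k=0,\dots,n$. A property holds for the general linear system of dimension $n+1$ and rank $r$ if there is a nonempty Zariski open subset of this parameter space such that the property holds for every system of dimension $n+1$ and rank $r$ arising from a point of that subset. *)

theory Defs
  imports "HOL-Analysis.Analysis" "HOL-Library.Function_Algebras"
begin

(* Forms in the homogeneous coordinates x_0,...,x_n are represented by the polynomial functions
   they induce on complex^'n, where CARD('n) = n + 1; the complex numbers being infinite, this
   loses nothing. *)

definition linear_form :: "complex^'n \<Rightarrow> complex^'n \<Rightarrow> complex" where
  "linear_form a x = (\<Sum>j\<in>UNIV. a $ j * x $ j)"

definition quadratic_form :: "(complex^'n \<Rightarrow> complex) \<Rightarrow> bool" where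
  "quadratic_form q \<longleftrightarrow> (\<exists>B :: complex^'n^'n. q = (\<lambda>x. \<Sum>i\<in>UNIV. \<Sum>j\<in>UNIV. B $ i $ j * x $ i * x $ j))"

(* Provides forms.span, forms.dim, ... for complex-valued functions. *)
global_interpretation forms: vector_space "\<lambda>(c::complex) (f :: 'a \<Rightarrow> complex) x. c * f x"
  by unfold_locales (auto simp: algebra_simps)

definition linear_system :: "(complex^'n \<Rightarrow> complex) set \<Rightarrow> bool" where
  "linear_system L \<longleftrightarrow> forms.subspace L \<and> (\<forall>q\<in>L. quadratic_form q)"

(* Q lists n + 1 generators of L; they need not be independent. *)
definition generators :: "('n \<Rightarrow> complex^'n \<Rightarrow> complex) \<Rightarrow> (complex^'n \<Rightarrow> complex) set \<Rightarrow> bool" where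
  "generators Q L \<longleftrightarrow> forms.span (range Q) = L"

definition system_rank :: "(complex^'n \<Rightarrow> complex) set \<Rightarrow> nat" where
  "system_rank L =
     (LEAST r. \<exists>l :: nat \<Rightarrow> complex^'n. L \<subseteq> forms.span ((\<lambda>i x. (linear_form (l i) x)\<^sup>2) ` {..<r}))"

(* On polynomial functions the complex derivative along a coordinate axis is the formal
   partial derivative. *)
definition partial :: "'n \<Rightarrow> (complex^'n \<Rightarrow> complex) \<Rightarrow> complex^'n \<Rightarrow> complex" where
  "partial i f x = deriv (\<lambda>t. f (x + t *s axis i 1)) 0"

definition weddle_matrix :: "('n \<Rightarrow> complex^'n \<Rightarrow> complex) \<Rightarrow> complex^'n \<Rightarrow> complex^'n^'n" where
  "weddle_matrix Q x = (\<chi> i k. partial i (Q k) x)"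

definition weddle_form :: "('n \<Rightarrow> complex^'n \<Rightarrow> complex) \<Rightarrow> complex^'n \<Rightarrow> complex" where
  "weddle_form Q x = det (weddle_matrix Q x)"

(* A point of projective space is a line through the origin of complex^'n.  For quadratic
   forms Q both conditions below are homogeneous in v, so they do not depend on the representative v of the point. *)
definition weddle_locus :: "('n::finite \<Rightarrow> complex^'n \<Rightarrow> complex) \<Rightarrow> (complex^'n) set set" where
  "weddle_locus Q = {vec.span {v} | v. v \<noteq> 0 \<and> weddle_form Q v = 0}"

(* Singularity refers to the equation weddle_form Q of the locus.  That such points
   lie on weddle_locus Q is Euler's identity. *)
definition weddle_singular_points ::
    "('n::finite \<Rightarrow> complex^'n \<Rightarrow> complex) \<Rightarrow> (complex^'n) set set" where
  "weddle_singular_points Q =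
     {vec.span {v} | v. v \<noteq> 0 \<and> (\<forall>i. partial i (weddle_form Q) v = 0)}"

(* Parameters (l, A): the rows l $ i are the coefficient vectors of r = CARD('r) linear forms, and
   A is an r x (n+1) matrix. *)
type_synonym ('r, 'n) params = "(complex^'n^'r) \<times> (complex^'n^'r)"

definition param_quadric :: "('r::finite, 'n::finite) params \<Rightarrow> 'n \<Rightarrow> complex^'n \<Rightarrow> complex" where
  "param_quadric p k x = (\<Sum>i\<in>UNIV. snd p $ i $ k * (linear_form (fst p $ i) x)\<^sup>2)"

definition param_system :: "('r::finite, 'n::finite) params \<Rightarrow> (complex^'n \<Rightarrow> complex) set" where
  "param_system p = forms.span (range (param_quadric p))"

lemma linear_system_param_system:
  fixes p :: "('r::finite, 'n::finite) params"
  shows "linear_system (param_system p)"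
proof -
  have "quadratic_form (param_quadric p k)" for k
  proof -
    let ?l = "\<lambda>i. fst p $ i" and ?c = "\<lambda>i. snd p $ i $ k"
    let ?B = "\<chi> a b. \<Sum>i\<in>UNIV. ?c i * ?l i $ a * ?l i $ b"
    have "param_quadric p k x = (\<Sum>a\<in>UNIV. \<Sum>b\<in>UNIV. ?B $ a $ b * x $ a * x $ b)" for x
    proof -
      have "param_quadric p k x =
          (\<Sum>i\<in>UNIV. \<Sum>a\<in>UNIV. \<Sum>b\<in>UNIV. ?c i * ?l i $ a * ?l i $ b * x $ a * x $ b)"
        unfolding param_quadric_def linear_form_def power2_eq_square sum_product
        by (intro sum.cong refl) (simp add: sum_distrib_left mult_ac)
      also have "\<dots> = (\<Sum>a\<in>UNIV. \<Sum>i\<in>UNIV. \<Sum>b\<in>UNIV. ?c i * ?l i $ a * ?l i $ b * x $ a * x $ b)"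
        by (rule sum.swap)
      also have "\<dots> = (\<Sum>a\<in>UNIV. \<Sum>b\<in>UNIV. \<Sum>i\<in>UNIV. ?c i * ?l i $ a * ?l i $ b * x $ a * x $ b)"
        by (intro sum.cong refl sum.swap)
      finally show ?thesis
        by (simp add: sum_distrib_right)
    qed
    then show ?thesis
      unfolding quadratic_form_def by blast
  qed
  moreover have "forms.subspace {q :: complex^'n \<Rightarrow> complex. quadratic_form q}"
    unfolding forms.subspace_def
  proof (safe)
    show "quadratic_form (0 :: complex^'n \<Rightarrow> complex)"
      unfolding quadratic_form_def by (rule exI[of _ 0]) auto
  next
    fix f g :: "complex^'n \<Rightarrow> complex" assume "quadratic_form f" "quadratic_form g"
    then obtain B C :: "complex^'n^'n" where
      "f = (\<lambda>x. \<Sum>i\<in>UNIV. \<Sum>j\<in>UNIV. B $ i $ j * x $ i * x $ j)"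
      "g = (\<lambda>x. \<Sum>i\<in>UNIV. \<Sum>j\<in>UNIV. C $ i $ j * x $ i * x $ j)"
      unfolding quadratic_form_def by blast
    then show "quadratic_form (f + g)"
      unfolding quadratic_form_def
      by (intro exI[of _ "B + C"]) (auto simp: sum.distrib algebra_simps)
  next
    fix c and f :: "complex^'n \<Rightarrow> complex" assume "quadratic_form f"
    then obtain B :: "complex^'n^'n" where
      "f = (\<lambda>x. \<Sum>i\<in>UNIV. \<Sum>j\<in>UNIV. B $ i $ j * x $ i * x $ j)"
      unfolding quadratic_form_def by blast
    then show "quadratic_form (\<lambda>x. c * f x)"
      unfolding quadratic_form_def
      by (intro exI[of _ "\<chi> i j. c * B $ i $ j"]) (auto simp: sum_distrib_left algebra_simps)
  qed
  ultimately have "param_system p \<subseteq> {q. quadratic_form q}"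
    unfolding param_system_def by (intro forms.span_minimal) auto
  then show ?thesis
    by (auto simp: linear_system_def param_system_def forms.subspace_span)
qed

inductive_set param_polynomials :: "(('r::finite, 'n::finite) params \<Rightarrow> complex) set" where
  const: "(\<lambda>p. c) \<in> param_polynomials"
| form_coeff: "(\<lambda>p. fst p $ i $ j) \<in> param_polynomials"
| matrix_entry: "(\<lambda>p. snd p $ i $ k) \<in> param_polynomials"
| add: "f \<in> param_polynomials \<Longrightarrow> g \<in> param_polynomials \<Longrightarrow> (\<lambda>p. f p + g p) \<in> param_polynomials"
| mult: "f \<in> param_polynomials \<Longrightarrow> g \<in> param_polynomials \<Longrightarrow> (\<lambda>p. f p * g p) \<in> param_polynomials"

definition zariski_closed :: "('r::finite, 'n::finite) params set \<Rightarrow> bool" where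
  "zariski_closed S \<longleftrightarrow> (\<exists>F \<subseteq> param_polynomials. S = {p. \<forall>f\<in>F. f p = 0})"

definition zariski_open :: "('r::finite, 'n::finite) params set \<Rightarrow> bool" where
  "zariski_open U \<longleftrightarrow> zariski_closed (- U)"

end

(* Write M for the 5 x 4 matrix of the linear forms l_i. The Weddle matrix is 2 M^T diag(l_i) A, so
   its determinant is a combination of the products of four of the five forms l_i. In the coordinates
   y_1, ..., y_4 given by l_1, ..., l_4, scaled so that l_5 = y_1 + ... + y_4 =: S, it is up to a
   constant the Hessian quartic
   prod y (1 + S sum e_i / y_i) of a cubic surface. Its ten singular points are the points where three of
   the five planes of the pentahedron y_1 y_2 y_3 y_4 S = 0 meet. On two of the planes, vanishing
   of the gradient forces a third; off the planes it forces y_i^2 = - e_i S^2 for all i, so that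
   suitable square roots of the - e_i add up to 1. The product over all signs of such sums is a
   polynomial in the e_i, whose nonvanishing is one of the conditions defining the open set.
   The ten points correspond to the subsets of {1, 2, 3, 4} of size 1 or 2, as supports.
   A different choice of generators multiplies the determinant by a nonzero constant. *)
theory Submission
  imports Defs
begin

section \<open>Determinants of order four and the index type \<open>5\<close>\<close>

lemma det_4:
  "det (A :: 'a::comm_ring_1^4^4) =
     A$1$1 * (A$2$2 * (A$3$3 * A$4$4 - A$3$4 * A$4$3) - A$2$3 * (A$3$2 * A$4$4 - A$3$4 * A$4$2)
       + A$2$4 * (A$3$2 * A$4$3 - A$3$3 * A$4$2))
   - A$1$2 * (A$2$1 * (A$3$3 * A$4$4 - A$3$4 * A$4$3) - A$2$3 * (A$3$1 * A$4$4 - A$3$4 * A$4$1)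
       + A$2$4 * (A$3$1 * A$4$3 - A$3$3 * A$4$1))
   + A$1$3 * (A$2$1 * (A$3$2 * A$4$4 - A$3$4 * A$4$2) - A$2$2 * (A$3$1 * A$4$4 - A$3$4 * A$4$1)
       + A$2$4 * (A$3$1 * A$4$2 - A$3$2 * A$4$1))
   - A$1$4 * (A$2$1 * (A$3$2 * A$4$3 - A$3$3 * A$4$2) - A$2$2 * (A$3$1 * A$4$3 - A$3$3 * A$4$1)
       + A$2$3 * (A$3$1 * A$4$2 - A$3$2 * A$4$1))"
proof -
  have f1: "finite {2::4, 3, 4}" "1 \<notin> {2::4, 3, 4}" by auto
  have f2: "finite {3::4, 4}" "2 \<notin> {3::4, 4}" by auto
  have f3: "finite {4::4}" "3 \<notin> {4::4}" by auto
  show ?thesis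
    unfolding det_def UNIV_4
    unfolding sum_over_permutations_insert[OF f1]
    unfolding sum_over_permutations_insert[OF f2]
    unfolding sum_over_permutations_insert[OF f3]
    unfolding permutes_sing
    by (simp add: sign_swap_id permutation_swap_id permutation_compose sign_compose sign_id swap_id_eq algebra_simps)
qed

lemma exhaust_5: "x = 1 \<or> x = 2 \<or> x = 3 \<or> x = 4 \<or> x = 5" for x :: 5
proof (induct x)
  case (of_int z)
  then have "z = 0 \<or> z = 1 \<or> z = 2 \<or> z = 3 \<or> z = 4" by fastforce
  then show ?case by auto
qed

lemma UNIV_5: "UNIV = {1, 2, 3, 4, 5 :: 5}"
  using exhaust_5 by auto

text \<open>In type \<^typ>\<open>4\<close> the numeral 4 is 0, and in type \<^typ>\<open>5\<close> the numeral 5 is 0,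
  so there is no order-preserving cast.\<close>

definition low :: "4 \<Rightarrow> 5" where
  "low i = (if i = 1 then 1 else if i = 2 then 2 else if i = 3 then 3 else 4)"

lemma sum_5_low: "sum f (UNIV :: 5 set) = (\<Sum>i\<in>UNIV. f (low i)) + f 5"
  for f :: "5 \<Rightarrow> 'a::comm_monoid_add"
  unfolding UNIV_5 by (simp add: sum_4 low_def ac_simps)

text \<open>The minors of size two of the rank one part vanish, so the determinant is affine in
  \<open>z\<close>.\<close>

lemma det_diag_plus_rank_one:
  fixes y t s :: "'a::comm_ring_1^4"
  shows "det (\<chi> i j. (if i = j then y $ i else 0) + z * t $ i * s $ j) =
    y$1 * y$2 * y$3 * y$4 + z * (t$1 * s$1 * (y$2 * y$3 * y$4) + t$2 * s$2 * (y$1 * y$3 * y$4)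
      + t$3 * s$3 * (y$1 * y$2 * y$4) + t$4 * s$4 * (y$1 * y$2 * y$3))"
  by (simp add: det_4 algebra_simps)

section \<open>The fifth row in terms of the first four\<close>

definition top_block :: "complex^4^5 \<Rightarrow> complex^4^4" where
  "top_block M = (\<chi> i. M $ low i)"

text \<open>Numerator of Cramer's rule for the fifth row. It stands apart from \<open>coord\<close>
  because it is polynomial in the entries of \<open>M\<close>, as the equation of the open set
  requires.\<close>

definition minor :: "complex^4^5 \<Rightarrow> 4 \<Rightarrow> complex" where
  "minor M k = det (\<chi> i j. if j = k then M $ 5 $ i else transpose (top_block M) $ i $ j)"

definition coord :: "complex^4^5 \<Rightarrow> complex^4" where
  "coord M = (\<chi> k. minor M k / det (top_block M))"

lemma last_row_coord:
  assumes "det (top_block M) \<noteq> 0"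
  shows "M $ 5 $ i = (\<Sum>k\<in>UNIV. coord M $ k * M $ low k $ i)"
proof -
  have "transpose (top_block M) *v coord M = M $ 5"
    using assms by (subst cramer) (simp_all add: coord_def minor_def)
  then show ?thesis
    by (auto simp: vec_eq_iff matrix_vector_mult_def transpose_def top_block_def mult.commute)
qed

section \<open>Partial derivatives and change of generators\<close>

lemma linear_form_line: "linear_form a (x + t *s axis i 1) = linear_form a x + t * a $ i"
proof -
  have "(\<Sum>j\<in>UNIV. a $ j * (t * axis i 1 $ j)) = t * a $ i"
    by (simp add: axis_def if_distrib cong: if_cong)
  then show ?thesis
    by (simp add: linear_form_def distrib_left sum.distrib)
qed

lemma has_derivative_linear_form:
  "((\<lambda>t. linear_form a (x + t *s axis i 1)) has_field_derivative a $ i) (at t)"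
  unfolding linear_form_line by (auto intro!: derivative_eq_intros)

lemma has_derivative_param_quadric:
  "((\<lambda>t. param_quadric p k (x + t *s axis i 1)) has_field_derivative
     (\<Sum>r\<in>UNIV. 2 * fst p $ r $ i * linear_form (fst p $ r) x * snd p $ r $ k)) (at 0)"
  unfolding param_quadric_def
  by (rule derivative_eq_intros has_derivative_linear_form sum.cong refl | simp)+

text \<open>Partial derivatives are linear in the quadric. Column \<open>k\<close> of
  \<open>G\<close> holds the coefficients of \<open>Q k\<close>, so a change of generators acts by
  multiplication on the right.\<close>

lemma weddle_matrix_combination:
  assumes "\<And>k x. Q k x = (\<Sum>j\<in>UNIV. G $ j $ k * param_quadric p j x)"
  shows "weddle_matrix Q x = weddle_matrix (param_quadric p) x ** G"
proof -
  have "partial i (Q k) x = (\<Sum>j\<in>UNIV. partial i (param_quadric p j) x * G $ j $ k)" for i k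
  proof -
    have "((\<lambda>t. Q k (x + t *s axis i 1)) has_field_derivative
        (\<Sum>j\<in>UNIV. G $ j $ k *
          (\<Sum>r\<in>UNIV. 2 * fst p $ r $ i * linear_form (fst p $ r) x * snd p $ r $ j))) (at 0)"
      unfolding assms by (intro DERIV_sum DERIV_cmult has_derivative_param_quadric)
    then show ?thesis
      unfolding partial_def by (simp add: DERIV_imp_deriv[OF has_derivative_param_quadric] DERIV_imp_deriv mult.commute)
  qed
  then show ?thesis
    by (simp add: weddle_matrix_def matrix_matrix_mult_def)
qed

lemma span_range_imp_combination:
  fixes f :: "'k::finite \<Rightarrow> 'a \<Rightarrow> complex"
  assumes "q \<in> forms.span (range f)"
  shows "\<exists>g. \<forall>x. q x = (\<Sum>j\<in>UNIV. g j * f j x)"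
proof -
  let ?S = "{q. \<exists>g. \<forall>x. q x = (\<Sum>j\<in>UNIV. g j * f j x)}"
  have "forms.span (range f) \<subseteq> ?S"
  proof (rule forms.span_minimal)
    show "range f \<subseteq> ?S"
    proof clarify
      fix k show "\<exists>g. \<forall>x. f k x = (\<Sum>j\<in>UNIV. g j * f j x)"
        by (rule exI[of _ "\<lambda>j. if j = k then 1 else 0"]) (simp add: if_distrib[of "\<lambda>u. u * _"] cong: if_cong)
    qed
    show "forms.subspace ?S"
      unfolding forms.subspace_def
    proof safe
      show "\<exists>g. \<forall>x. (0 :: 'a \<Rightarrow> complex) x = (\<Sum>j\<in>UNIV. g j * f j x)"
        by (rule exI[of _ "\<lambda>_. 0"]) simp
    next
      fix u v g h
      assume "\<forall>x. u x = (\<Sum>j\<in>UNIV. g j * f j x)" "\<forall>x. v x = (\<Sum>j\<in>UNIV. h j * f j x)"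
      then show "\<exists>g. \<forall>x. (u + v) x = (\<Sum>j\<in>UNIV. g j * f j x)"
        by (intro exI[of _ "\<lambda>j. g j + h j"]) (simp add: sum.distrib algebra_simps)
    next
      fix c u g
      assume "\<forall>x. u x = (\<Sum>j\<in>UNIV. g j * f j x)"
      then show "\<exists>g. \<forall>x. c * u x = (\<Sum>j\<in>UNIV. g j * f j x)"
        by (intro exI[of _ "\<lambda>j. c * g j"]) (simp add: sum_distrib_left algebra_simps)
    qed
  qed
  with assms show ?thesis by blast
qed

text \<open>Passing to \<open>Q\<close> and back multiplies the Weddle matrix at \<open>x0\<close>
  by \<open>G ** H\<close> without changing it. Cancelling its nonzero determinant gives
  \<open>det G * det H = 1\<close>, and \<open>c\<close> is \<open>det G\<close>.\<close>

lemma weddle_form_generators: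
  assumes gen: "generators Q (param_system p)"
    and nz: "weddle_form (param_quadric p) x0 \<noteq> 0"
  obtains c where "c \<noteq> 0" "\<And>x. weddle_form Q x = c * weddle_form (param_quadric p) x"
proof -
  have spans: "forms.span (range Q) = forms.span (range (param_quadric p))"
    using gen by (simp add: generators_def param_system_def)
  have "\<exists>g. \<forall>x. Q k x = (\<Sum>j\<in>UNIV. g j * param_quadric p j x)" for k
    using spans by (intro span_range_imp_combination) (metis forms.span_base rangeI)
  then obtain g where g: "\<And>k x. Q k x = (\<Sum>j\<in>UNIV. g k j * param_quadric p j x)"
    by metis
  have "\<exists>h. \<forall>x. param_quadric p k x = (\<Sum>j\<in>UNIV. h j * Q j x)" for k
    using spans by (intro span_range_imp_combination) (metis forms.span_base rangeI)
  then obtain h where h: "\<And>k x. param_quadric p k x = (\<Sum>j\<in>UNIV. h k j * Q j x)"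
    by metis
  define G where "G = (\<chi> j k. g k j)"
  define H where "H = (\<chi> j k. h k j)"
  have Q: "weddle_matrix Q x = weddle_matrix (param_quadric p) x ** G" for x
    by (rule weddle_matrix_combination) (simp add: G_def g)
  have "weddle_matrix (param_quadric p) x0 = weddle_matrix (param_quadric p) x0 ** (G ** H)"
  proof (rule weddle_matrix_combination)
    fix k x
    have "param_quadric p k x = (\<Sum>i\<in>UNIV. \<Sum>j\<in>UNIV. h k i * g i j * param_quadric p j x)"
      by (subst h) (simp add: g sum_distrib_left mult.assoc)
    also have "\<dots> = (\<Sum>j\<in>UNIV. \<Sum>i\<in>UNIV. h k i * g i j * param_quadric p j x)"
      by (rule sum.swap)
    finally show "param_quadric p k x = (\<Sum>j\<in>UNIV. (G ** H) $ j $ k * param_quadric p j x)"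
      by (simp add: matrix_matrix_mult_def G_def H_def sum_distrib_right sum_distrib_left mult_ac)
  qed
  then have "det (weddle_matrix (param_quadric p) x0) = det (weddle_matrix (param_quadric p) x0) * (det G * det H)"
    by (metis det_mul)
  with nz have "det G \<noteq> 0"
    by (auto simp: weddle_form_def)
  then show thesis
    by (rule that) (simp add: weddle_form_def Q det_mul mult.commute)
qed

section \<open>Reduction of the Weddle form to the Hessian quartic\<close>

text \<open>In Sylvester's pentahedral form this is \<open>y1 y2 y3 y4 (1 + S (e1/y1 + e2/y2 + e3/y3 + e4/y4))\<close>
  with \<open>S = y1 + y2 + y3 + y4\<close>, the fifth face of the pentahedron being \<open>S = 0\<close>.\<close>

definition hessian_quartic :: "complex^4 \<Rightarrow> complex^4 \<Rightarrow> complex" where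
  "hessian_quartic e y = y$1 * y$2 * y$3 * y$4 + (y$1 + y$2 + y$3 + y$4) *
     (e$1 * (y$2 * y$3 * y$4) + e$2 * (y$1 * y$3 * y$4) + e$3 * (y$1 * y$2 * y$4) + e$4 * (y$1 * y$2 * y$3))"

text \<open>The scaling makes the rows add up to the fifth row of \<open>M\<close> when the top
  block is invertible, so that the fifth form becomes the sum of the new coordinates.\<close>

definition pentahedron_matrix :: "complex^4^5 \<Rightarrow> complex^4^4" where
  "pentahedron_matrix M = (\<chi> i. coord M $ i *s (M $ low i))"

text \<open>Expressing both fifth rows through the first four factors the Weddle matrix as
  \<open>transpose T ** D ** A\<close>, where \<open>D\<close> is diagonal plus rank one.\<close>

lemma weddle_form_param:
  fixes p :: "(5, 4) params"
  defines "T \<equiv> top_block (fst p)" and "A \<equiv> top_block (snd p)"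
    and "t \<equiv> coord (fst p)" and "s \<equiv> coord (snd p)"
  assumes T: "det T \<noteq> 0" and A: "det A \<noteq> 0" and t: "\<And>i. t $ i \<noteq> 0"
  shows "weddle_form (param_quadric p) x =
    16 * det T * det A / (t$1 * t$2 * t$3 * t$4) *
      hessian_quartic (\<chi> i. (t $ i)\<^sup>2 * s $ i) (pentahedron_matrix (fst p) *v x)"
proof -
  define l where "l i = fst p $ low i" for i
  define y where "y = (\<chi> i. linear_form (l i) x)"
  define z where "z = (\<Sum>k\<in>UNIV. t $ k * y $ k)"
  define D where "D = (\<chi> i j. (if i = j then (2 *s y) $ i else 0) + (2 * z) * t $ i * s $ j)"
  have M5: "fst p $ 5 $ i = (\<Sum>k\<in>UNIV. t $ k * l k $ i)" for i
    using last_row_coord[of "fst p"] T by (simp add: T_def t_def l_def)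
  have A5: "snd p $ 5 $ i = (\<Sum>k\<in>UNIV. s $ k * A $ k $ i)" for i
    using last_row_coord[of "snd p"] A by (simp add: A_def s_def top_block_def)
  have z: "linear_form (fst p $ 5) x = z"
    unfolding linear_form_def M5 z_def y_def
    by (simp add: sum_distrib_left sum_distrib_right mult_ac) (rule sum.swap)
  have "weddle_matrix (param_quadric p) x $ i $ k = (transpose T ** D ** A) $ i $ k" for i k
  proof -
    have "weddle_matrix (param_quadric p) x $ i $ k =
        (\<Sum>r\<in>UNIV. 2 * fst p $ r $ i * linear_form (fst p $ r) x * snd p $ r $ k)"
      by (simp add: weddle_matrix_def partial_def DERIV_imp_deriv[OF has_derivative_param_quadric])
    also have "\<dots> = (\<Sum>j\<in>UNIV. 2 * l j $ i * y $ j * A $ j $ k) +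
        2 * (\<Sum>j\<in>UNIV. t $ j * l j $ i) * z * (\<Sum>j\<in>UNIV. s $ j * A $ j $ k)"
      by (simp add: sum_5_low z M5 A5 y_def A_def top_block_def l_def)
    also have "\<dots> = (transpose T ** D ** A) $ i $ k"
      by (simp add: matrix_matrix_mult_def D_def transpose_def T_def top_block_def sum_4 algebra_simps
          flip: l_def)
    finally show ?thesis .
  qed
  then have "weddle_matrix (param_quadric p) x = transpose T ** D ** A"
    by (simp add: vec_eq_iff)
  then have "weddle_form (param_quadric p) x = det T * det D * det A"
    by (simp add: weddle_form_def det_mul)
  \<comment> \<open>Each weight takes one factor \<open>t $ i\<close> from the rank one part and
    another from rewriting the cubic products in the scaled coordinates.\<close>
  moreover have "det D = 16 / (t$1 * t$2 * t$3 * t$4) *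
      hessian_quartic (\<chi> i. (t $ i)\<^sup>2 * s $ i) (\<chi> i. t $ i * y $ i)"
    using t unfolding D_def det_diag_plus_rank_one hessian_quartic_def
    by (simp add: z_def sum_4 power2_eq_square field_simps)
  moreover have "(\<chi> i. t $ i * y $ i) = pentahedron_matrix (fst p) *v x"
    by (simp add: pentahedron_matrix_def matrix_vector_mult_def vec_eq_iff y_def l_def t_def
        linear_form_def sum_distrib_left mult.assoc)
  ultimately show ?thesis by simp
qed

section \<open>Singular points of the Hessian quartic\<close>

definition quartic_gradient :: "complex^4 \<Rightarrow> complex^4 \<Rightarrow> complex^4" where
  "quartic_gradient e y = (let S = y$1 + y$2 + y$3 + y$4;
     E = e$1 * (y$2 * y$3 * y$4) + e$2 * (y$1 * y$3 * y$4) + e$3 * (y$1 * y$2 * y$4) + e$4 * (y$1 * y$2 * y$3)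
   in \<chi> i. if i = 1 then y$2 * y$3 * y$4 + E + S * (e$2 * y$3 * y$4 + e$3 * y$2 * y$4 + e$4 * y$2 * y$3)
      else if i = 2 then y$1 * y$3 * y$4 + E + S * (e$1 * y$3 * y$4 + e$3 * y$1 * y$4 + e$4 * y$1 * y$3)
      else if i = 3 then y$1 * y$2 * y$4 + E + S * (e$1 * y$2 * y$4 + e$2 * y$1 * y$4 + e$4 * y$1 * y$2)
      else y$1 * y$2 * y$3 + E + S * (e$1 * y$2 * y$3 + e$2 * y$1 * y$3 + e$3 * y$1 * y$2))"

lemma has_derivative_hessian_quartic:
  assumes "\<And>j. ((\<lambda>t. f t $ j) has_field_derivative b $ j) (at u)"
  shows "((\<lambda>t. hessian_quartic e (f t)) has_field_derivative
    (\<Sum>j\<in>UNIV. b $ j * quartic_gradient e (f u) $ j)) (at u)"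
  unfolding hessian_quartic_def
  by (rule DERIV_cong, (rule assms DERIV_cmult DERIV_add DERIV_mult)+)
     (simp add: sum_4 quartic_gradient_def Let_def, simp add: algebra_simps)

lemma has_derivative_hessian_quartic_line:
  "((\<lambda>t. hessian_quartic e (N *v (x + t *s axis i 1))) has_field_derivative
     (\<Sum>j\<in>UNIV. N $ j $ i * quartic_gradient e (N *v x) $ j)) (at 0)"
proof -
  have "((\<lambda>t. (N *v (x + t *s axis i 1)) $ j) has_field_derivative column i N $ j) (at 0)" for j
    using has_derivative_linear_form[of "N $ j"]
    by (simp add: linear_form_def matrix_vector_mult_def column_def)
  from has_derivative_hessian_quartic[where f = "\<lambda>t. N *v (x + t *s axis i 1)" and u = 0, OF this]
  show ?thesis
    by (simp add: column_def)
qed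

text \<open>By the chain rule the gradients differ by \<open>c\<close> and the invertible matrix
  \<open>transpose N\<close>.\<close>

lemma singular_quartic_pullback:
  assumes "\<And>x. f x = c * hessian_quartic e (N *v x)" and c: "c \<noteq> 0" and N: "det N \<noteq> 0"
  shows "(\<forall>i. partial i f v = 0) \<longleftrightarrow> quartic_gradient e (N *v v) = 0"
proof -
  have "partial i f v = c * (transpose N *v quartic_gradient e (N *v v)) $ i" for i
    unfolding partial_def assms(1)
    by (subst DERIV_imp_deriv[OF DERIV_cmult[OF has_derivative_hessian_quartic_line]])
       (simp add: matrix_vector_mult_def transpose_def)
  then have "(\<forall>i. partial i f v = 0) \<longleftrightarrow> transpose N *v quartic_gradient e (N *v v) = 0"
    using c by (simp add: vec_eq_iff)
  also have "\<dots> \<longleftrightarrow> quartic_gradient e (N *v v) = 0"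
  proof -
    have "invertible (transpose N)" using N by (simp add: invertible_det_nz)
    then show ?thesis
      by (metis (no_types) invertible_def matrix_vector_mul_assoc matrix_vector_mul_lid matrix_vector_mult_0_right)
  qed
  finally show ?thesis .
qed

text \<open>The quartic is a combination of products of four of the five faces. If three faces
  vanish, each product contains at least two of them, so its derivatives vanish too.\<close>

lemma node_gradient_eq_0:
  assumes "y$1 = 0 \<and> y$2 = 0 \<and> y$3 = 0 \<or> y$1 = 0 \<and> y$2 = 0 \<and> y$4 = 0 \<or> y$1 = 0 \<and> y$3 = 0 \<and> y$4 = 0 \<or>
    y$2 = 0 \<and> y$3 = 0 \<and> y$4 = 0 \<or>
    y$1 + y$2 + y$3 + y$4 = 0 \<and> (y$1 = 0 \<and> y$2 = 0 \<or> y$1 = 0 \<and> y$3 = 0 \<or> y$1 = 0 \<and> y$4 = 0 \<or>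
      y$2 = 0 \<and> y$3 = 0 \<or> y$2 = 0 \<and> y$4 = 0 \<or> y$3 = 0 \<and> y$4 = 0)"
  shows "quartic_gradient e y = 0"
  using assms by (elim disjE conjE) (simp_all add: quartic_gradient_def Let_def vec_eq_iff)

text \<open>When the \<open>e i\<close> are nonzero, \<^term>\<open>hessian_quartic e\<close> has a singular point off the pentahedron
  exactly in this case: there \<open>s = y / S\<close>.\<close>

definition split_sum :: "complex^4 \<Rightarrow> bool" where
  "split_sum e \<longleftrightarrow> (\<exists>s. (\<forall>i. (s $ i)\<^sup>2 = - (e $ i)) \<and> s$1 + s$2 + s$3 + s$4 = 1)"

text \<open>Here \<open>x\<close> is one coordinate, \<open>Y\<close> the product of the other
  three, and \<open>grad\<close> the partial derivative along \<open>x\<close>. Eliminating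
  \<open>R\<close> between \<open>grad\<close> and \<open>euler\<close> gives
  \<open>x * E = S * e * Y\<close>.\<close>

lemma square_off_pentahedron:
  fixes x Y S E e R :: complex
  assumes euler: "x * Y + S * E = 0" and E: "E = e * Y + x * R" and grad: "Y + E + S * R = 0" and "Y \<noteq> 0"
  shows "x\<^sup>2 = - (S\<^sup>2 * e)"
proof -
  have "x * E - S * e * Y = x * (Y + E + S * R) - (x * Y + S * E)"
    by (simp add: E algebra_simps)
  then have "x * E = S * e * Y" using euler grad by simp
  moreover have "x\<^sup>2 * Y = - S * (x * E)"
    using euler by algebra
  ultimately have "x\<^sup>2 * Y = - (S\<^sup>2 * e) * Y"
    by (simp add: power2_eq_square)
  then show ?thesis using \<open>Y \<noteq> 0\<close> by (metis mult_right_cancel)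
qed

lemma quartic_gradient_eq_0D:
  assumes grad: "quartic_gradient e y = 0" and e: "\<And>i. e $ i \<noteq> 0" and ns: "\<not> split_sum e"
  shows "y$1 = 0 \<and> y$2 = 0 \<and> y$3 = 0 \<or> y$1 = 0 \<and> y$2 = 0 \<and> y$4 = 0 \<or> y$1 = 0 \<and> y$3 = 0 \<and> y$4 = 0 \<or>
    y$2 = 0 \<and> y$3 = 0 \<and> y$4 = 0 \<or>
    y$1 + y$2 + y$3 + y$4 = 0 \<and> (y$1 = 0 \<and> y$2 = 0 \<or> y$1 = 0 \<and> y$3 = 0 \<or> y$1 = 0 \<and> y$4 = 0 \<or>
      y$2 = 0 \<and> y$3 = 0 \<or> y$2 = 0 \<and> y$4 = 0 \<or> y$3 = 0 \<and> y$4 = 0)"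
proof -
  define S where "S = y$1 + y$2 + y$3 + y$4"
  define E where "E = e$1 * (y$2 * y$3 * y$4) + e$2 * (y$1 * y$3 * y$4) + e$3 * (y$1 * y$2 * y$4) + e$4 * (y$1 * y$2 * y$3)"
  have g1: "y$2 * y$3 * y$4 + E + S * (e$2 * y$3 * y$4 + e$3 * y$2 * y$4 + e$4 * y$2 * y$3) = 0"
    and g2: "y$1 * y$3 * y$4 + E + S * (e$1 * y$3 * y$4 + e$3 * y$1 * y$4 + e$4 * y$1 * y$3) = 0"
    and g3: "y$1 * y$2 * y$4 + E + S * (e$1 * y$2 * y$4 + e$2 * y$1 * y$4 + e$4 * y$1 * y$2) = 0"
    and g4: "y$1 * y$2 * y$3 + E + S * (e$1 * y$2 * y$3 + e$2 * y$1 * y$3 + e$3 * y$1 * y$2) = 0"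
    using grad unfolding vec_eq_iff forall_4
    by (simp_all add: quartic_gradient_def Let_def S_def E_def)
  have e': "e$1 \<noteq> 0" "e$2 \<noteq> 0" "e$3 \<noteq> 0" "e$4 \<noteq> 0" using e by auto
  let ?P = "y$1 * y$2 * y$3 * y$4"
  have euler: "?P + S * E = 0"
  proof -
    \<comment> \<open>Euler's identity in degree four: the partial derivatives are weighted by the
      coordinates and added.\<close>
    have "4 * (?P + S * E) = 0"
      using g1 g2 g3 g4 unfolding S_def E_def by algebra
    then show ?thesis by (metis mult_eq_0_iff zero_neq_numeral)
  qed
  have "S * ?P = 0"
  proof (rule ccontr)
    assume "S * ?P \<noteq> 0"
    then have nz: "S \<noteq> 0" "y$1 \<noteq> 0" "y$2 \<noteq> 0" "y$3 \<noteq> 0" "y$4 \<noteq> 0" by auto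
    have sq1: "(y$1)\<^sup>2 = - (S\<^sup>2 * e$1)"
    proof (rule square_off_pentahedron)
      show "y$1 * (y$2 * y$3 * y$4) + S * E = 0" using euler by (simp add: mult_ac)
      show "E = e$1 * (y$2 * y$3 * y$4) + y$1 * (e$2 * y$3 * y$4 + e$3 * y$2 * y$4 + e$4 * y$2 * y$3)"
        by (simp add: E_def algebra_simps)
    qed (use g1 nz in simp_all)
    have sq2: "(y$2)\<^sup>2 = - (S\<^sup>2 * e$2)"
    proof (rule square_off_pentahedron)
      show "y$2 * (y$1 * y$3 * y$4) + S * E = 0" using euler by (simp add: mult_ac)
      show "E = e$2 * (y$1 * y$3 * y$4) + y$2 * (e$1 * y$3 * y$4 + e$3 * y$1 * y$4 + e$4 * y$1 * y$3)"
        by (simp add: E_def algebra_simps)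
    qed (use g2 nz in simp_all)
    have sq3: "(y$3)\<^sup>2 = - (S\<^sup>2 * e$3)"
    proof (rule square_off_pentahedron)
      show "y$3 * (y$1 * y$2 * y$4) + S * E = 0" using euler by (simp add: mult_ac)
      show "E = e$3 * (y$1 * y$2 * y$4) + y$3 * (e$1 * y$2 * y$4 + e$2 * y$1 * y$4 + e$4 * y$1 * y$2)"
        by (simp add: E_def algebra_simps)
    qed (use g3 nz in simp_all)
    have sq4: "(y$4)\<^sup>2 = - (S\<^sup>2 * e$4)"
    proof (rule square_off_pentahedron)
      show "y$4 * (y$1 * y$2 * y$3) + S * E = 0" using euler by (simp add: mult_ac)
      show "E = e$4 * (y$1 * y$2 * y$3) + y$4 * (e$1 * y$2 * y$3 + e$2 * y$1 * y$3 + e$3 * y$1 * y$2)"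
        by (simp add: E_def algebra_simps)
    qed (use g4 nz in simp_all)
    have "(y $ i)\<^sup>2 = - (S\<^sup>2 * e $ i)" for i
      using exhaust_4[of i] sq1 sq2 sq3 sq4 by auto
    then have "split_sum e"
      unfolding split_sum_def
      by (intro exI[of _ "\<chi> i. y $ i / S"])
         (use nz in \<open>simp add: power_divide S_def flip: add_divide_distrib\<close>)
    with ns show False by contradiction
  qed
  then have "?P = 0"
    using euler by auto
  with euler have "S * E = 0"
    by (metis add_0)
  have z: "y$1 = 0 \<or> y$2 = 0 \<or> y$3 = 0 \<or> y$4 = 0"
    using \<open>?P = 0\<close> by auto
  \<comment> \<open>The facts \<open>c\<close> lead from one face to a second; \<open>b\<close> (a
    coordinate plane and \<open>S = 0\<close>) and \<open>a\<close> (two coordinate planes) lead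
    from two faces to a third. Each relation collapses to a nonzero weight times a product of the
    remaining faces.\<close>
  have c1: "y$1 = 0 \<Longrightarrow> S = 0 \<or> y$2 = 0 \<or> y$3 = 0 \<or> y$4 = 0"
    using \<open>S * E = 0\<close> e' by (simp add: E_def)
  have b1: "y$1 = 0 \<Longrightarrow> S = 0 \<Longrightarrow> y$2 = 0 \<or> y$3 = 0 \<or> y$4 = 0"
    using g2 e' by (simp add: E_def)
  have a12: "y$1 = 0 \<Longrightarrow> y$2 = 0 \<Longrightarrow> S = 0 \<or> y$3 = 0 \<or> y$4 = 0"
    using g1 e' by (simp add: E_def)
  have a13: "y$1 = 0 \<Longrightarrow> y$3 = 0 \<Longrightarrow> S = 0 \<or> y$2 = 0 \<or> y$4 = 0"
    using g1 e' by (simp add: E_def)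
  have a14: "y$1 = 0 \<Longrightarrow> y$4 = 0 \<Longrightarrow> S = 0 \<or> y$2 = 0 \<or> y$3 = 0"
    using g1 e' by (simp add: E_def)
  have c2: "y$2 = 0 \<Longrightarrow> S = 0 \<or> y$1 = 0 \<or> y$3 = 0 \<or> y$4 = 0"
    using \<open>S * E = 0\<close> e' by (simp add: E_def)
  have b2: "y$2 = 0 \<Longrightarrow> S = 0 \<Longrightarrow> y$1 = 0 \<or> y$3 = 0 \<or> y$4 = 0"
    using g1 e' by (simp add: E_def)
  have a23: "y$2 = 0 \<Longrightarrow> y$3 = 0 \<Longrightarrow> S = 0 \<or> y$1 = 0 \<or> y$4 = 0"
    using g2 e' by (simp add: E_def)
  have a24: "y$2 = 0 \<Longrightarrow> y$4 = 0 \<Longrightarrow> S = 0 \<or> y$1 = 0 \<or> y$3 = 0"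
    using g2 e' by (simp add: E_def)
  have c3: "y$3 = 0 \<Longrightarrow> S = 0 \<or> y$1 = 0 \<or> y$2 = 0 \<or> y$4 = 0"
    using \<open>S * E = 0\<close> e' by (simp add: E_def)
  have b3: "y$3 = 0 \<Longrightarrow> S = 0 \<Longrightarrow> y$1 = 0 \<or> y$2 = 0 \<or> y$4 = 0"
    using g1 e' by (simp add: E_def)
  have a34: "y$3 = 0 \<Longrightarrow> y$4 = 0 \<Longrightarrow> S = 0 \<or> y$1 = 0 \<or> y$2 = 0"
    using g3 e' by (simp add: E_def)
  have c4: "y$4 = 0 \<Longrightarrow> S = 0 \<or> y$1 = 0 \<or> y$2 = 0 \<or> y$3 = 0"
    using \<open>S * E = 0\<close> e' by (simp add: E_def)
  have b4: "y$4 = 0 \<Longrightarrow> S = 0 \<Longrightarrow> y$1 = 0 \<or> y$2 = 0 \<or> y$3 = 0"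
    using g1 e' by (simp add: E_def)
  show ?thesis
    using z c1 b1 a12 a13 a14 c2 b2 a23 a24 c3 b3 a34 c4 b4
    unfolding S_def[symmetric] by satx
qed

section \<open>Supports and the count of ten points\<close>

definition support :: "complex^4 \<Rightarrow> 4 set" where
  "support y = {i. y $ i \<noteq> 0}"

lemma card_support: "card (support y) = (\<Sum>i\<in>UNIV. of_bool (y $ i \<noteq> 0))"
  by (simp add: support_def)

text \<open>Three coordinate planes meet where one coordinate survives; two of them meet the face
  \<open>S = 0\<close> where the two surviving coordinates are opposite.\<close>

lemma quartic_gradient_eq_0_iff:
  assumes "\<And>i. e $ i \<noteq> 0" and "\<not> split_sum e"
  shows "y \<noteq> 0 \<and> quartic_gradient e y = 0 \<longleftrightarrow>
    card (support y) = 1 \<or> card (support y) = 2 \<and> (\<Sum>i\<in>UNIV. y $ i) = 0"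
  using quartic_gradient_eq_0D[OF _ assms, of y] node_gradient_eq_0[of y e]
  unfolding card_support sum_4 vec_eq_iff[of y 0] forall_4
  by (cases "y$1 = 0"; cases "y$2 = 0"; cases "y$3 = 0"; cases "y$4 = 0") auto

lemma card_one_two_subsets: "card {I :: 4 set. card I = 1 \<or> card I = 2} = 10"
proof -
  have n: "card {I :: 4 set. card I = k} = 4 choose k" for k
    using n_subsets[of "UNIV :: 4 set" k] by simp
  have "{I :: 4 set. card I = 1 \<or> card I = 2} = {I. card I = 1} \<union> {I. card I = 2}" by blast
  also have "card \<dots> = card {I :: 4 set. card I = 1} + card {I :: 4 set. card I = 2}"
    by (intro card_Un_disjoint) auto
  also have "\<dots> = 10" unfolding n by (simp add: choose_two)
  finally show ?thesis .
qed

lemma vec_span_scale: "c \<noteq> 0 \<Longrightarrow> vec.span {c *s v} = vec.span {v}" for v :: "complex^'n"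
proof -
  assume c: "c \<noteq> 0"
  have "v \<in> vec.span {c *s v}"
    using c vec.span_scale[OF vec.span_base[of "c *s v" "{c *s v}"], of "inverse c"] by simp
  moreover have "c *s v \<in> vec.span {v}"
    by (intro vec.span_scale vec.span_base) simp
  ultimately show ?thesis
    by (simp add: vec.span_eq)
qed

definition node :: "complex^4 \<Rightarrow> bool" where
  "node y \<longleftrightarrow> card (support y) = 1 \<or> card (support y) = 2 \<and> (\<Sum>i\<in>UNIV. y $ i) = 0"

lemma sum_support: "(\<Sum>i\<in>UNIV. y $ i) = (\<Sum>i\<in>support y. y $ i)"
  by (rule sum.mono_neutral_right) (auto simp: support_def)

lemma exists_node_support:
  assumes "card I = 1 \<or> card I = 2"
  shows "\<exists>y. support y = I \<and> node y"
  using assms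
proof
  assume "card I = 1"
  then obtain i where I: "I = {i}" by (rule card_1_singletonE)
  then have "support (axis i 1) = I" by (auto simp: support_def axis_def)
  with \<open>card I = 1\<close> show ?thesis by (auto simp: node_def)
next
  assume "card I = 2"
  then obtain i j where I: "I = {i, j}" "i \<noteq> j" by (auto simp: card_2_iff)
  let ?y = "axis i 1 - axis j 1 :: complex^4"
  have s: "support ?y = I" using I by (auto simp: support_def axis_def)
  have "(\<Sum>i\<in>UNIV. ?y $ i) = 0"
    unfolding sum_support s using I by (simp add: axis_def)
  with \<open>card I = 2\<close> s show ?thesis by (auto simp: node_def)
qed

text \<open>A node is a multiple of an axis vector or, by the zero sum, of a difference of two axis
  vectors. Hence the support determines the projective point.\<close>

lemma node_support_eq_imp_scale:
  assumes y: "node y" and y': "node y'" and eq: "support y = support y'"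
  shows "\<exists>c. y' = c *s y"
proof -
  from y consider "card (support y) = 1" | "card (support y) = 2"
    by (auto simp: node_def)
  then show ?thesis
  proof cases
    case 1
    then obtain i where i: "support y = {i}" by (rule card_1_singletonE)
    then have "y $ i \<noteq> 0" "\<And>k. k \<noteq> i \<Longrightarrow> y $ k = 0 \<and> y' $ k = 0"
      using eq by (auto simp: support_def)
    then have "y' $ k = (y' $ i / y $ i) * y $ k" for k by (cases "k = i") auto
    then show ?thesis by (metis vec_eq_iff vector_smult_component)
  next
    case 2
    then obtain i j where ij: "support y = {i, j}" "i \<noteq> j" by (auto simp: card_2_iff)
    have "(\<Sum>k\<in>support y. y $ k) = 0" "(\<Sum>k\<in>support y'. y' $ k) = 0"
      using y y' 2 eq by (simp_all add: node_def sum_support)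
    then have "y $ i + y $ j = 0" "y' $ i + y' $ j = 0"
      using ij by (simp_all flip: eq)
    then have j: "y $ j = - y $ i" "y' $ j = - y' $ i"
      by (simp_all add: add_eq_0_iff)
    have "y $ i \<noteq> 0" "\<And>k. k \<noteq> i \<Longrightarrow> k \<noteq> j \<Longrightarrow> y $ k = 0 \<and> y' $ k = 0"
      using eq ij by (auto simp: support_def)
    then have "y' $ k = (y' $ i / y $ i) * y $ k" for k
      by (cases "k = i"; cases "k = j") (auto simp: j)
    then show ?thesis by (metis vec_eq_iff vector_smult_component)
  qed
qed

lemma card_node_lines:
  assumes "det N \<noteq> 0"
  shows "card {vec.span {v} | v. node (N *v v)} = 10"
proof -
  let ?K = "{I :: 4 set. card I = 1 \<or> card I = 2}"
  obtain M where MN: "N ** M = mat 1" "M ** N = mat 1"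
    using assms by (auto simp: invertible_det_nz[symmetric] invertible_def)
  then have NM[simp]: "N *v (M *v y) = y" "M *v (N *v y) = y" for y
    by (simp_all add: matrix_vector_mul_assoc)
  have M_scale: "M *v (c *s y) = c *s (M *v y)" and N_scale: "N *v (c *s y) = c *s (N *v y)" for c y
    by (rule vector_scalar_commute)+
  have "\<forall>I\<in>?K. \<exists>y. support y = I \<and> node y"
    by (simp add: exists_node_support)
  from bchoice[OF this] obtain Y where Y_all: "\<forall>I\<in>?K. support (Y I) = I \<and> node (Y I)" ..
  then have Y: "support (Y I) = I" "node (Y I)" if "I \<in> ?K" for I
    using bspec[OF Y_all that] by simp_all
  have "inj_on (\<lambda>I. vec.span {M *v Y I}) ?K"
  proof (rule inj_onI)
    fix I J assume I: "I \<in> ?K" and J: "J \<in> ?K" and "vec.span {M *v Y I} = vec.span {M *v Y J}"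
    then have "M *v Y I \<in> vec.span {M *v Y J}"
      by (metis insertI1 vec.span_base)
    then obtain c where "M *v Y I = c *s (M *v Y J)"
      by (auto simp: vec.span_singleton)
    then have c: "Y I = c *s Y J"
      by (metis NM(1) N_scale)
    \<comment> \<open>The sets in \<open>?K\<close> are nonempty, which excludes the scalar 0; a
      nonzero scalar preserves supports.\<close>
    have "support (Y I) \<noteq> {}" using I Y[OF I] by auto
    then have "c \<noteq> 0" using c by (auto simp: support_def)
    then have "support (Y I) = support (Y J)" using c by (simp add: support_def)
    then show "I = J" using Y[OF I] Y[OF J] by simp
  qed
  moreover have "{vec.span {v} | v. node (N *v v)} = (\<lambda>I. vec.span {M *v Y I}) ` ?K"
  proof (intro equalityI subsetI)
    fix l assume "l \<in> {vec.span {v} | v. node (N *v v)}"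
    then obtain v where l: "l = vec.span {v}" and v: "node (N *v v)" by blast
    let ?I = "support (N *v v)"
    have I: "?I \<in> ?K" using v by (auto simp: node_def)
    obtain c where c: "N *v v = c *s Y ?I"
      using node_support_eq_imp_scale[of "Y ?I" "N *v v"] Y[OF I] v by auto
    have "?I \<noteq> {}" using I by auto
    then have "c \<noteq> 0" using c by (auto simp: support_def)
    moreover have "v = c *s (M *v Y ?I)"
      by (metis NM(2) M_scale c)
    ultimately have "l = vec.span {M *v Y ?I}"
      using l vec_span_scale by metis
    with I show "l \<in> (\<lambda>I. vec.span {M *v Y I}) ` ?K" by blast
  next
    fix l assume "l \<in> (\<lambda>I. vec.span {M *v Y I}) ` ?K"
    then obtain I where "I \<in> ?K" and l: "l = vec.span {M *v Y I}" by blast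
    then have "node (N *v (M *v Y I))"
      using Y(2)[of I] by simp
    with l show "l \<in> {vec.span {v} | v. node (N *v v)}" by blast
  qed
  ultimately show ?thesis
    by (simp only: card_image card_one_two_subsets)
qed

lemma card_weddle_singular_points:
  assumes "\<And>x. weddle_form Q x = c * hessian_quartic e (N *v x)"
    and "c \<noteq> 0" "det N \<noteq> 0" "\<And>i. e $ i \<noteq> 0" "\<not> split_sum e"
  shows "card (weddle_singular_points Q) = 10"
proof -
  have "v \<noteq> 0 \<longleftrightarrow> N *v v \<noteq> 0" for v
    using \<open>det N \<noteq> 0\<close>
    by (metis invertible_def invertible_det_nz matrix_vector_mul_assoc matrix_vector_mul_lid matrix_vector_mult_0_right)
  then have "v \<noteq> 0 \<and> (\<forall>i. partial i (weddle_form Q) v = 0) \<longleftrightarrow> node (N *v v)" for v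
    using singular_quartic_pullback[OF assms(1-3)] quartic_gradient_eq_0_iff[OF assms(4,5)]
    unfolding node_def by metis
  then show ?thesis
    using card_node_lines[OF \<open>det N \<noteq> 0\<close>] by (simp add: weddle_singular_points_def)
qed

section \<open>The norm of a sum of square roots\<close>

text \<open>The product of \<open>x5 \<plusminus> x1 \<plusminus> x2 \<plusminus> x3 \<plusminus> x4\<close> over all choices of signs, as a polynomial in the squares \<open>di\<close>
  of the \<open>xi\<close>. With \<open>X = (x5 - x4)\<^sup>2 = a - 2 x4 x5\<close>, the quartic equation
  \<open>(X\<^sup>2 + p X + q)\<^sup>2 = 4 d3 X (2 X + r)\<^sup>2\<close> characterises the values \<open>X = (x1 \<plusminus> x2 \<plusminus> x3)\<^sup>2\<close>; it reads \<open>E - 2 x4 x5 F = 0\<close>,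
  and the norm is \<open>E\<^sup>2 - (2 x4 x5)\<^sup>2 F\<^sup>2\<close>.\<close>

definition sqrt_sum_norm :: "complex \<Rightarrow> complex \<Rightarrow> complex \<Rightarrow> complex \<Rightarrow> complex \<Rightarrow> complex" where
  "sqrt_sum_norm d1 d2 d3 d4 d5 = (let
     b = - 2 * (d1 + d2); g = (d1 - d2) * (d1 - d2);
     p = 6 * d3 + b; q = d3 * d3 + b * d3 + g; r = 2 * d3 + b;
     a = d4 + d5; m = 4 * d4 * d5;
     U = a * a + m + p * a + q; V = 2 * a + p;
     S = 4 * (a * a * a + 3 * a * m) + 4 * r * (a * a + m) + r * r * a;
     T = 4 * (3 * a * a + m) + 8 * r * a + r * r;
     E = U * U + m * V * V - 4 * d3 * S; F = 2 * U * V - 4 * d3 * T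
   in E * E - m * F * F)"

lemma sqrt_sum_norm_eq_0:
  assumes x: "x1 + x2 + x3 + x4 = x5"
  shows "sqrt_sum_norm (x1\<^sup>2) (x2\<^sup>2) (x3\<^sup>2) (x4\<^sup>2) (x5\<^sup>2) = 0"
proof -
  define b where "b = - 2 * (x1\<^sup>2 + x2\<^sup>2)"
  define g where "g = (x1\<^sup>2 - x2\<^sup>2) * (x1\<^sup>2 - x2\<^sup>2)"
  define p where "p = 6 * x3\<^sup>2 + b"
  define q where "q = x3\<^sup>2 * x3\<^sup>2 + b * x3\<^sup>2 + g"
  define r where "r = 2 * x3\<^sup>2 + b"
  define a where "a = x4\<^sup>2 + x5\<^sup>2"
  define m where "m = 4 * x4\<^sup>2 * x5\<^sup>2"
  define U where "U = a * a + m + p * a + q"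
  define V where "V = 2 * a + p"
  define S where "S = 4 * (a * a * a + 3 * a * m) + 4 * r * (a * a + m) + r * r * a"
  define T where "T = 4 * (3 * a * a + m) + 8 * r * a + r * r"
  define E where "E = U * U + m * V * V - 4 * x3\<^sup>2 * S"
  define F where "F = 2 * U * V - 4 * x3\<^sup>2 * T"
  define y where "y = x1 + x2 + x3"
  define w where "w = - 2 * x4 * x5"
  have w: "w * w = m" unfolding w_def m_def by algebra
  have yw: "y * y = a + w" unfolding y_def a_def w_def x[symmetric] by algebra
  \<comment> \<open>For \<open>z = y - x3 = x1 + x2\<close> one has
    \<open>z^4 + b * z^2 + g = 0\<close>. Expanded in \<open>y\<close>, the even powers stand on the
    left and the odd ones on the right, so that squaring leaves only squares of \<open>y\<close> and
    \<open>x3\<close>.\<close>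
  have root: "(y * y) * (y * y) + p * (y * y) + q = 2 * x3 * y * (2 * (y * y) + r)"
    unfolding p_def q_def r_def b_def g_def y_def by algebra
  have "U + w * V = (y * y) * (y * y) + p * (y * y) + q"
    unfolding yw U_def V_def w[symmetric] by (simp add: algebra_simps)
  then have "(U + w * V) * (U + w * V) = 4 * x3\<^sup>2 * ((y * y) * (2 * (y * y) + r) * (2 * (y * y) + r))"
    unfolding root by (simp add: power2_eq_square)
  also have "(y * y) * (2 * (y * y) + r) * (2 * (y * y) + r) = S + w * T"
    unfolding yw S_def T_def w[symmetric] by (simp add: algebra_simps)
  finally have EF: "E + w * F = 0"
    unfolding E_def F_def w[symmetric] by (simp add: algebra_simps)
  \<comment> \<open>The conjugate factor replaces \<open>x4\<close> by its negative; only
    \<open>w * w = m\<close> survives in the product.\<close>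
  have "E * E - m * F * F = (E + w * F) * (E - w * F)"
    unfolding w[symmetric] by (simp add: algebra_simps)
  also have "\<dots> = 0" using EF by simp
  finally show ?thesis
    unfolding sqrt_sum_norm_def Let_def E_def F_def S_def T_def U_def V_def m_def a_def p_def q_def r_def b_def g_def .
qed

section \<open>Polynomials in the parameters and the open set\<close>

lemma param_poly_uminus: "f \<in> param_polynomials \<Longrightarrow> (\<lambda>p. - f p) \<in> param_polynomials"
  using param_polynomials.mult[OF param_polynomials.const[of "-1"], of f] by simp

lemma param_poly_diff:
  "f \<in> param_polynomials \<Longrightarrow> g \<in> param_polynomials \<Longrightarrow> (\<lambda>p. f p - g p) \<in> param_polynomials"
  using param_polynomials.add[OF _ param_poly_uminus, of f g] by simp

lemma param_poly_sum:
  "(\<And>i. i \<in> I \<Longrightarrow> f i \<in> param_polynomials) \<Longrightarrow> (\<lambda>p. \<Sum>i\<in>I. f i p) \<in> param_polynomials"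
  by (induction I rule: infinite_finite_induct) (auto intro: param_polynomials.intros)

lemma param_poly_prod:
  "(\<And>i. i \<in> I \<Longrightarrow> f i \<in> param_polynomials) \<Longrightarrow> (\<lambda>p. \<Prod>i\<in>I. f i p) \<in> param_polynomials"
  by (induction I rule: infinite_finite_induct) (auto intro: param_polynomials.intros)

lemma param_poly_det:
  "(\<And>i j. (\<lambda>p. F p $ i $ j) \<in> param_polynomials) \<Longrightarrow> (\<lambda>p. det (F p)) \<in> param_polynomials"
  unfolding det_def by (intro param_poly_sum param_poly_prod param_polynomials.mult param_polynomials.const)

lemma param_poly_top_block:
  assumes "\<And>r i. (\<lambda>p. M p $ r $ i) \<in> param_polynomials"
  shows "(\<lambda>p. det (top_block (M p))) \<in> param_polynomials"
  using assms by (intro param_poly_det) (simp add: top_block_def)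

lemma param_poly_minor:
  assumes "\<And>r i. (\<lambda>p. M p $ r $ i) \<in> param_polynomials"
  shows "(\<lambda>p. minor (M p) k) \<in> param_polynomials"
  unfolding minor_def
proof (rule param_poly_det)
  fix i j
  show "(\<lambda>p. (\<chi> i j. if j = k then M p $ 5 $ i else transpose (top_block (M p)) $ i $ j) $ i $ j)
      \<in> param_polynomials"
    using assms by (cases "j = k") (simp_all add: top_block_def transpose_def)
qed

lemma param_poly_sqrt_sum_norm:
  assumes "f1 \<in> param_polynomials" "f2 \<in> param_polynomials" "f3 \<in> param_polynomials"
    "f4 \<in> param_polynomials" "f5 \<in> param_polynomials"
  shows "(\<lambda>p. sqrt_sum_norm (f1 p) (f2 p) (f3 p) (f4 p) (f5 p)) \<in> param_polynomials"
  unfolding sqrt_sum_norm_def Let_def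
  by (intro assms param_polynomials.add param_polynomials.mult param_poly_uminus param_poly_diff param_polynomials.const)

text \<open>The first factors make both top blocks invertible and all coordinates of the fifth rows
  nonzero. In the norm, \<open>- e i\<close> and 1 are multiplied by the common denominator
  \<open>d * d * a\<close>, giving \<open>c i\<close> and the last argument.\<close>

definition genericity :: "(5, 4) params \<Rightarrow> complex" where
  "genericity p = (let d = det (top_block (fst p)); a = det (top_block (snd p));
      c = (\<lambda>i. - (minor (fst p) i * minor (fst p) i * minor (snd p) i))
    in d * a * (\<Prod>i\<in>UNIV. c i) * sqrt_sum_norm (c 1) (c 2) (c 3) (c 4) (d * d * a))"

lemma genericity_polynomial: "genericity \<in> param_polynomials"
proof -
  have "(\<lambda>p. genericity p) \<in> param_polynomials"
    unfolding genericity_def Let_def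
    by (intro param_poly_sqrt_sum_norm param_poly_prod param_polynomials.mult param_poly_uminus
        param_poly_top_block param_poly_minor
        param_polynomials.form_coeff param_polynomials.matrix_entry)
  then show ?thesis by simp
qed

lemma generic_not_split_sum:
  assumes "genericity p \<noteq> 0"
  shows "\<not> split_sum (\<chi> i. (coord (fst p) $ i)\<^sup>2 * coord (snd p) $ i)"
proof
  define d where "d = det (top_block (fst p))"
  define a where "a = det (top_block (snd p))"
  define c where "c i = - (minor (fst p) i * minor (fst p) i * minor (snd p) i)" for i
  have d: "d \<noteq> 0" and a: "a \<noteq> 0" and n: "sqrt_sum_norm (c 1) (c 2) (c 3) (c 4) (d * d * a) \<noteq> 0"
    using assms by (auto simp: genericity_def d_def a_def c_def)
  assume "split_sum (\<chi> i. (coord (fst p) $ i)\<^sup>2 * coord (snd p) $ i)"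
  then obtain s where s: "\<And>i. (s $ i)\<^sup>2 = - ((coord (fst p) $ i)\<^sup>2 * coord (snd p) $ i)"
      and sum: "s$1 + s$2 + s$3 + s$4 = 1"
    by (auto simp: split_sum_def)
  \<comment> \<open>Multiplying the \<open>s $ i\<close> by a square root of the common denominator
    turns their squares into the \<open>c i\<close> and their sum into \<open>t\<close>.\<close>
  define t where "t = csqrt (d * d * a)"
  have t: "t\<^sup>2 = d * d * a" by (simp add: t_def)
  have c: "c i = (t * s $ i)\<^sup>2" for i
    using d a by (simp add: power_mult_distrib t s coord_def c_def flip: d_def a_def) (simp add: power2_eq_square)
  have "t * s$1 + t * s$2 + t * s$3 + t * s$4 = t"
    using sum by (metis distrib_left mult.right_neutral)
  from sqrt_sum_norm_eq_0[OF this] n show False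
    by (simp add: c t)
qed

lemma generic_card_weddle_singular_points:
  assumes gen: "genericity p \<noteq> 0" and Q: "generators Q (param_system p)"
  shows "card (weddle_singular_points Q) = 10"
proof -
  let ?N = "pentahedron_matrix (fst p)"
  let ?e = "\<chi> i. (coord (fst p) $ i)\<^sup>2 * coord (snd p) $ i"
  have T: "det (top_block (fst p)) \<noteq> 0" and A: "det (top_block (snd p)) \<noteq> 0"
    and "(\<Prod>i\<in>UNIV. - (minor (fst p) i * minor (fst p) i * minor (snd p) i)) \<noteq> 0"
    using gen by (auto simp: genericity_def Let_def)
  then have t: "coord (fst p) $ i \<noteq> 0" and s: "coord (snd p) $ i \<noteq> 0" for i
    by (simp_all add: coord_def)
  define K where "K = 16 * det (top_block (fst p)) * det (top_block (snd p)) /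
    (coord (fst p)$1 * coord (fst p)$2 * coord (fst p)$3 * coord (fst p)$4)"
  have W: "weddle_form (param_quadric p) x = K * hessian_quartic ?e (?N *v x)" for x
    unfolding K_def by (rule weddle_form_param[OF T A t])
  have K: "K \<noteq> 0" using T A t by (simp add: K_def)
  have "?N = (\<chi> i. coord (fst p) $ i *s (top_block (fst p) $ i))"
    by (simp add: pentahedron_matrix_def top_block_def)
  then have "det ?N = (\<Prod>i\<in>UNIV. coord (fst p) $ i) * det (top_block (fst p))"
    by (simp add: det_rows_mul)
  then have N: "det ?N \<noteq> 0" using t T by simp
  then obtain M where "?N ** M = mat 1"
    by (auto simp: invertible_det_nz[symmetric] invertible_def)
  then have NM: "?N *v (M *v y) = y" for y
    by (simp add: matrix_vector_mul_assoc)
  \<comment> \<open>The coordinates add up to 0, so the quartic reduces to their product, which is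
    -3.\<close>
  let ?y = "\<chi> i. if i = 4 then - 3 else 1"
  have "weddle_form (param_quadric p) (M *v ?y) \<noteq> 0"
    unfolding W NM using K by (simp add: hessian_quartic_def)
  then obtain c where "c \<noteq> 0" "\<And>x. weddle_form Q x = c * weddle_form (param_quadric p) x"
    using weddle_form_generators[OF Q] by blast
  then have "\<And>x. weddle_form Q x = (c * K) * hessian_quartic ?e (?N *v x)" "c * K \<noteq> 0"
    using W K by simp_all
  then show ?thesis
    using t s N generic_not_split_sum[OF gen]
    by (intro card_weddle_singular_points[where e = ?e and N = ?N and c = "c * K"]) auto
qed

section \<open>A parameter in the open set\<close>

definition fermat_rows :: "complex \<Rightarrow> complex^4^5" where
  "fermat_rows u = (\<chi> r i. if r = 5 then u else if r = low i then 1 else 0)"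

lemma low_simps: "low i \<noteq> 5" "low i = low j \<longleftrightarrow> i = j"
  using exhaust_4[of i] exhaust_4[of j] by (auto simp: low_def)

lemma minor_fermat_rows: "top_block (fermat_rows u) = mat 1" "minor (fermat_rows u) k = u"
proof -
  show T: "top_block (fermat_rows u) = mat 1"
    by (simp add: top_block_def fermat_rows_def mat_def vec_eq_iff low_simps eq_commute)
  have "coord (fermat_rows u) $ k = minor (fermat_rows u) k"
    by (simp add: coord_def T)
  moreover have "u = (\<Sum>j\<in>UNIV. coord (fermat_rows u) $ j * fermat_rows u $ low j $ k)"
    using last_row_coord[of "fermat_rows u" k] T by (simp add: fermat_rows_def)
  moreover have "\<dots> = coord (fermat_rows u) $ k"
    by (simp add: fermat_rows_def low_simps if_distrib[of "\<lambda>z. _ * z"] cong: if_cong)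
  ultimately show "minor (fermat_rows u) k = u" by simp
qed

text \<open>The quadrics are the squares of the coordinates minus the square of their sum, up to
  constants the polars of the Clebsch diagonal cubic. All arguments of the norm are 1, and a signed
  sum of five ones is odd, hence nonzero.\<close>

lemma genericity_nonzero: "genericity (fermat_rows 1, fermat_rows (- 1)) \<noteq> 0"
  by (simp add: genericity_def minor_fermat_rows sqrt_sum_norm_def Let_def)

theorem theorem3p9:
  "\<exists>U :: (5, 4) params set.
     zariski_open U \<and> U \<noteq> {} \<and>
     (\<forall>p\<in>U. \<forall>L.
        L = param_system p \<and> linear_system L \<and> forms.dim L = 4 \<and> system_rank L = 5 \<longrightarrow>
        (\<forall>Q. generators Q L \<longrightarrow> card (weddle_singular_points Q) = 10))"
proof (intro exI conjI)
  let ?U = "{p. genericity p \<noteq> 0}"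
  show "zariski_open ?U"
    unfolding zariski_open_def zariski_closed_def
    using genericity_polynomial by (intro exI[of _ "{genericity}"]) auto
  show "?U \<noteq> {}"
    using genericity_nonzero by blast
  show "\<forall>p\<in>?U. \<forall>L.
        L = param_system p \<and> linear_system L \<and> forms.dim L = 4 \<and> system_rank L = 5 \<longrightarrow>
        (\<forall>Q. generators Q L \<longrightarrow> card (weddle_singular_points Q) = 10)"
    using generic_card_weddle_singular_points by blast
qed

end
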